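(* Assume the standing hypotheses of the context. Let $\lambda\ge\kappa$, $M\in K_\lambda$ and $p\in S(M)$. Then $U(p)\ge R^\lambda[p]$.
   Context: $K$ is an AEC with strong substructure $\prec$, Löwenheim–Skolem number $LS(K)$, amalgamation, joint embedding and no maximal models; work in a monster model $\mathfrak{C}$. Galois type $tp(\bar a/M)$ = orbit of a sequence under automorphisms of $\mathfrak{C}$ fixing $M$; $S(M)$ = types over $M$; for $M\prec N$, $p\le q$ means $q\upharpoonright M=p$. Standing hypotheses: $\kappa>LS(K)$ is such that $K$ is fully $<\kappa$-tame (distinct types over any model differ on a submodel of size $<\kappa$), fully $<\kappa$-type short (distinct types differ on a subsequence of length $<\kappa$), does not have the weak $\kappa$-order property (no $\alpha,\beta<\kappa$, model $M$ of size $<\kappa$, $p\neq q\in S^{\alpha+\beta}(M)$ and $\langle a_i,b_i:i<\kappa\rangle$ with $tp(a_ib_j/M)=p$ for $i\le j$, $=q$ for $i>j$), and non-forking satisfies (E): Existence ($A\downarrow_{M_0}M_0$ always) and Extension (if $M_0\prec N\prec N^+$ and $A\downarrow_{M_0}N$ there is $A'$ with $tp(A'/N)=tp(A/N)$, $A'\downarrow_{M_0}N^+$). Non-forking: for models $M_0\prec N$, $A\downarrow_{M_0}N$ iff for every subsequence $a$ of $A$ of length $<\kappa$ and every $N^-\prec N$ with $\|N^-\|<\kappa$, $tp(a/N^-)$ is realized in $M_0$. A forking extension of $p\in S(M)$ is $q\in S(N)$, $M\prec N$, $p\le q$, $q$ forking over $M$. U-rank: $U(p)\ge0$; for limit $\alpha$,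 $U(p)\ge\alpha$ iff $U(p)\ge\beta$ for all $\beta<\alpha$; $U(p)\ge\beta+1$ iff there are $M'\succ M$ with $\|M'\|=\|M\|$ and a forking extension $p'\in S(M')$ of $p$ with $U(p')\ge\beta$; $U(p)=\infty$ iff $U(p)\ge\alpha$ for all $\alpha$. Lieberman's rank $R^\lambda$ (for $M\in K_\lambda$, $p\in S(M)$): $R^\lambda[p]\ge0$; for limit $\alpha$, $R^\lambda[p]\ge\alpha$ iff $R^\lambda[p]\ge\beta$ for all $\beta<\alpha$; $R^\lambda[p]\ge\beta+1$ iff there are $M'\succ M$ and pairwise distinct $\langle p_i\in S(M'):i<\lambda^+\rangle$ with $p\le p_i$ and $R^\lambda[p_i]\ge\beta$ for all $i<\lambda^+$; for $\|M\|>\lambda$ and $p\in S(M)$, $R^\lambda[p]=\min\{R^\lambda[p\upharpoonright N]:N\prec M,\ \|N\|=\lambda\}$.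
   Formalization: Existence (A non-forking over M_0 from M_0) is assumed only for models M_0 of size at least κ; for smaller M_0 it is contradictory, since taking N^- = M_0 would put every element of the monster model into M_0. *)

theory Defs
  imports Main "HOL-Library.Extended"
begin

unbundle cardinal_syntax

section \<open>Structures\<close>

record ('f, 'r) vocabulary =
  fsyms :: "'f set"
  rsyms :: "'r set"
  farity :: "'f \<Rightarrow> nat"
  rarity :: "'r \<Rightarrow> nat"

record ('f, 'r, 'a) str =
  univ :: "'a set"
  fint :: "'f \<Rightarrow> 'a list \<Rightarrow> 'a"
  rint :: "'r \<Rightarrow> 'a list set"

definition args :: "('f, 'r, 'a) str \<Rightarrow> nat \<Rightarrow> 'a list set" where
  "args M n = {xs. length xs = n \<and> set xs \<subseteq> univ M}"

text \<open>Interpretations take a fixed value outside their proper domain, so that HOL equality of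
  structures is equality of structures.\<close>

definition is_structure :: "('f, 'r) vocabulary \<Rightarrow> ('f, 'r, 'a) str \<Rightarrow> bool" where
  "is_structure V M \<longleftrightarrow>
     univ M \<noteq> {} \<and>
     (\<forall>g\<in>fsyms V. \<forall>xs\<in>args M (farity V g). fint M g xs \<in> univ M) \<and>
     (\<forall>g xs. \<not> (g \<in> fsyms V \<and> xs \<in> args M (farity V g)) \<longrightarrow> fint M g xs = undefined) \<and>
     (\<forall>r\<in>rsyms V. rint M r \<subseteq> args M (rarity V r)) \<and>
     (\<forall>r. r \<notin> rsyms V \<longrightarrow> rint M r = {})"

definition substructure ::
    "('f, 'r) vocabulary \<Rightarrow> ('f, 'r, 'a) str \<Rightarrow> ('f, 'r, 'a) str \<Rightarrow> bool" where
  "substructure V M N \<longleftrightarrow>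
     is_structure V M \<and> is_structure V N \<and> univ M \<subseteq> univ N \<and>
     (\<forall>g\<in>fsyms V. \<forall>xs\<in>args M (farity V g). fint M g xs = fint N g xs) \<and>
     (\<forall>r\<in>rsyms V. rint M r = rint N r \<inter> args M (rarity V r))"

definition isomorphism ::
    "('f, 'r) vocabulary \<Rightarrow> ('f, 'r, 'a) str \<Rightarrow> ('f, 'r, 'a) str \<Rightarrow> ('a \<Rightarrow> 'a) \<Rightarrow> bool" where
  "isomorphism V M N h \<longleftrightarrow>
     is_structure V M \<and> is_structure V N \<and> bij_betw h (univ M) (univ N) \<and>
     (\<forall>g\<in>fsyms V. \<forall>xs\<in>args M (farity V g). h (fint M g xs) = fint N g (map h xs)) \<and>
     (\<forall>r\<in>rsyms V. \<forall>xs\<in>args M (rarity V r). xs \<in> rint M r \<longleftrightarrow> map h xs \<in> rint N r)"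

text \<open>For an increasing chain, the structure described here exists and is unique.\<close>

definition is_chain_union ::
    "('f, 'r) vocabulary \<Rightarrow> 'i set \<Rightarrow> ('i \<Rightarrow> ('f, 'r, 'a) str) \<Rightarrow> ('f, 'r, 'a) str \<Rightarrow> bool" where
  "is_chain_union V I M U \<longleftrightarrow>
     univ U = (\<Union>i\<in>I. univ (M i)) \<and> (\<forall>i\<in>I. substructure V (M i) U)"


section \<open>Abstract elementary classes\<close>

text \<open>The class is represented by its members whose universe is a subset of the type \<open>'a\<close>, which
  plays the role of a set large enough to carry the monster model. Cardinals are the cardinal
  orders of the library.\<close>

record ('f, 'r, 'a) aec =
  voc :: "('f, 'r) vocabulary"
  mods :: "('f, 'r, 'a) str set"
  prec :: "('f, 'r, 'a) str \<Rightarrow> ('f, 'r, 'a) str \<Rightarrow> bool"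

definition LS_bound :: "('f, 'r, 'a) aec \<Rightarrow> 'l rel \<Rightarrow> bool" where
  "LS_bound K \<mu> \<longleftrightarrow>
     Card_order \<mu> \<and> natLeq \<le>o \<mu> \<and> |fsyms (voc K) <+> rsyms (voc K)| \<le>o \<mu> \<and>
     (\<forall>M\<in>mods K. \<forall>A. A \<subseteq> univ M \<longrightarrow>
        (\<exists>N. prec K N M \<and> A \<subseteq> univ N \<and> |univ N| \<le>o |A| +c \<mu>))"

definition LS_number :: "('f, 'r, 'a) aec \<Rightarrow> 'l rel \<Rightarrow> bool" where
  "LS_number K ls \<longleftrightarrow> LS_bound K ls \<and> (\<forall>\<mu> :: 'l rel. LS_bound K \<mu> \<longrightarrow> ls \<le>o \<mu>)"

text \<open>In the chain axioms, index orders on \<open>'a\<close> suffice: a strictly increasing chain of subsets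
  of \<open>'a\<close> has order type below the cardinal successor of the cardinality of \<open>'a\<close>.\<close>

definition AEC :: "('f, 'r, 'a) aec \<Rightarrow> 'l rel \<Rightarrow> bool" where
  "AEC K ls \<longleftrightarrow>
     (\<forall>M\<in>mods K. is_structure (voc K) M) \<and>
     (\<forall>M N. prec K M N \<longrightarrow> M \<in> mods K \<and> N \<in> mods K \<and> substructure (voc K) M N) \<and>
     (\<forall>M\<in>mods K. prec K M M) \<and>
     (\<forall>M N P. prec K M N \<longrightarrow> prec K N P \<longrightarrow> prec K M P) \<and>
     (\<forall>M N h. M \<in> mods K \<longrightarrow> isomorphism (voc K) M N h \<longrightarrow> N \<in> mods K) \<and>
     (\<forall>M N M' N' h. prec K M N \<longrightarrow> isomorphism (voc K) N N' h \<longrightarrow> isomorphism (voc K) M M' h \<longrightarrow>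
        substructure (voc K) M' N' \<longrightarrow> prec K M' N') \<and>
     (\<forall>M0 M1 M2. prec K M0 M2 \<longrightarrow> prec K M1 M2 \<longrightarrow> univ M0 \<subseteq> univ M1 \<longrightarrow> prec K M0 M1) \<and>
     (\<forall>(r :: 'a rel) M U. Well_order r \<longrightarrow> Field r \<noteq> {} \<longrightarrow>
        (\<forall>i j. (i, j) \<in> r \<longrightarrow> prec K (M i) (M j)) \<longrightarrow> is_chain_union (voc K) (Field r) M U \<longrightarrow>
        U \<in> mods K \<and> (\<forall>i\<in>Field r. prec K (M i) U) \<and>
        (\<forall>N. (\<forall>i\<in>Field r. prec K (M i) N) \<longrightarrow> prec K U N)) \<and>
     LS_number K ls"

definition strong_embedding ::
    "('f, 'r, 'a) aec \<Rightarrow> ('a \<Rightarrow> 'a) \<Rightarrow> ('f, 'r, 'a) str \<Rightarrow> ('f, 'r, 'a) str \<Rightarrow> bool" where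
  "strong_embedding K h M N \<longleftrightarrow> (\<exists>N0. prec K N0 N \<and> isomorphism (voc K) M N0 h)"

definition amalgamation :: "('f, 'r, 'a) aec \<Rightarrow> bool" where
  "amalgamation K \<longleftrightarrow>
     (\<forall>M0 M1 M2. prec K M0 M1 \<longrightarrow> prec K M0 M2 \<longrightarrow>
        (\<exists>N h1 h2. strong_embedding K h1 M1 N \<and> strong_embedding K h2 M2 N \<and>
                   (\<forall>x\<in>univ M0. h1 x = h2 x)))"

definition joint_embedding :: "('f, 'r, 'a) aec \<Rightarrow> bool" where
  "joint_embedding K \<longleftrightarrow>
     (\<forall>M1\<in>mods K. \<forall>M2\<in>mods K.
        \<exists>N h1 h2. strong_embedding K h1 M1 N \<and> strong_embedding K h2 M2 N)"

text \<open>A proper strong embedding instead of a proper strong extension: the complement of the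
  universe of \<open>M\<close> in \<open>'a\<close> may be empty.\<close>

definition no_maximal_models :: "('f, 'r, 'a) aec \<Rightarrow> bool" where
  "no_maximal_models K \<longleftrightarrow>
     (\<forall>M\<in>mods K. \<exists>N h. strong_embedding K h M N \<and> h ` univ M \<noteq> univ N)"

definition monster :: "('f, 'r, 'a) aec \<Rightarrow> ('f, 'r, 'a) str \<Rightarrow> bool" where
  "monster K C \<longleftrightarrow>
     C \<in> mods K \<and>
     (\<forall>M\<in>mods K. |univ M| <o |univ C| \<longrightarrow> (\<exists>h. strong_embedding K h M C)) \<and>
     (\<forall>M N h. prec K M C \<longrightarrow> prec K N C \<longrightarrow> |univ M| <o |univ C| \<longrightarrow> isomorphism (voc K) M N h \<longrightarrow>
        (\<exists>h'. isomorphism (voc K) C C h' \<and> (\<forall>x\<in>univ M. h' x = h x)))"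

text \<open>The usual convention: the models under consideration are the strong substructures of the
  monster of smaller cardinality, and sequences live in the monster and have smaller length.\<close>

definition models :: "('f, 'r, 'a) aec \<Rightarrow> ('f, 'r, 'a) str \<Rightarrow> ('f, 'r, 'a) str set" where
  "models K C = {M. prec K M C \<and> |univ M| <o |univ C| }"


section \<open>Galois types\<close>

text \<open>A sequence is a partial map; its domain is the index set. Since types do not depend on an
  order of the index set, an index set of cardinality \<open>|\<alpha>|\<close> takes the place of an ordinal \<open>\<alpha>\<close>.
  Index sets contained in \<open>'a\<close> realize all lengths in question. A subsequence of \<open>a\<close> is a
  restriction \<open>a |` J\<close>.\<close>

definition seqs :: "('f, 'r, 'a) str \<Rightarrow> 'i set \<Rightarrow> ('i \<rightharpoonup> 'a) set" where
  "seqs C I = {a. dom a = I \<and> ran a \<subseteq> univ C \<and> |I| <o |univ C| }"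

definition aut_over ::
    "('f, 'r, 'a) aec \<Rightarrow> ('f, 'r, 'a) str \<Rightarrow> ('f, 'r, 'a) str \<Rightarrow> ('a \<Rightarrow> 'a) set" where
  "aut_over K C M = {h. isomorphism (voc K) C C h \<and> (\<forall>x\<in>univ M. h x = x)}"

definition gtp ::
    "('f, 'r, 'a) aec \<Rightarrow> ('f, 'r, 'a) str \<Rightarrow> ('i \<rightharpoonup> 'a) \<Rightarrow> ('f, 'r, 'a) str \<Rightarrow> ('i \<rightharpoonup> 'a) set" where
  "gtp K C a M = {map_option h \<circ> a | h. h \<in> aut_over K C M}"

definition gtypes_len ::
    "('f, 'r, 'a) aec \<Rightarrow> ('f, 'r, 'a) str \<Rightarrow> 'i set \<Rightarrow> ('f, 'r, 'a) str \<Rightarrow> ('i \<rightharpoonup> 'a) set set" where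
  "gtypes_len K C I M = {gtp K C a M | a. a \<in> seqs C I}"

definition gtypes ::
    "('f, 'r, 'a) aec \<Rightarrow> ('f, 'r, 'a) str \<Rightarrow> ('f, 'r, 'a) str \<Rightarrow> ('a \<rightharpoonup> 'a) set set" where
  "gtypes K C M = (\<Union>I. gtypes_len K C I M)"

definition gtp_restrict ::
    "('f, 'r, 'a) aec \<Rightarrow> ('f, 'r, 'a) str \<Rightarrow> ('i \<rightharpoonup> 'a) set \<Rightarrow> ('f, 'r, 'a) str \<Rightarrow> ('i \<rightharpoonup> 'a) set" where
  "gtp_restrict K C p N = (\<Union>a\<in>p. gtp K C a N)"

definition gtp_subseq :: "('i \<rightharpoonup> 'a) set \<Rightarrow> 'i set \<Rightarrow> ('i \<rightharpoonup> 'a) set" where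
  "gtp_subseq p J = {a |` J | a. a \<in> p}"

definition fully_tame :: "('f, 'r, 'a) aec \<Rightarrow> ('f, 'r, 'a) str \<Rightarrow> 'k rel \<Rightarrow> bool" where
  "fully_tame K C \<kappa> \<longleftrightarrow>
     (\<forall>M\<in>models K C. \<forall>I :: 'a set. \<forall>p\<in>gtypes_len K C I M. \<forall>q\<in>gtypes_len K C I M. p \<noteq> q \<longrightarrow>
        (\<exists>N. prec K N M \<and> |univ N| <o \<kappa> \<and> gtp_restrict K C p N \<noteq> gtp_restrict K C q N))"

definition fully_type_short :: "('f, 'r, 'a) aec \<Rightarrow> ('f, 'r, 'a) str \<Rightarrow> 'k rel \<Rightarrow> bool" where
  "fully_type_short K C \<kappa> \<longleftrightarrow>
     (\<forall>M\<in>models K C. \<forall>I :: 'a set. \<forall>p\<in>gtypes_len K C I M. \<forall>q\<in>gtypes_len K C I M. p \<noteq> q \<longrightarrow>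
        (\<exists>J\<subseteq>I. |J| <o \<kappa> \<and> gtp_subseq p J \<noteq> gtp_subseq q J))"

text \<open>\<open>case_sum a b\<close> is the concatenation of the sequences \<open>a\<close> and \<open>b\<close>.\<close>

definition weak_order_property :: "('f, 'r, 'a) aec \<Rightarrow> ('f, 'r, 'a) str \<Rightarrow> 'k rel \<Rightarrow> bool" where
  "weak_order_property K C \<kappa> \<longleftrightarrow>
     (\<exists>(I :: 'a set) (J :: 'a set) M p q a b.
        |I| <o \<kappa> \<and> |J| <o \<kappa> \<and> M \<in> models K C \<and> |univ M| <o \<kappa> \<and>
        p \<in> gtypes_len K C (I <+> J) M \<and> q \<in> gtypes_len K C (I <+> J) M \<and> p \<noteq> q \<and>
        (\<forall>i\<in>Field \<kappa>. a i \<in> seqs C I \<and> b i \<in> seqs C J) \<and>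
        (\<forall>i\<in>Field \<kappa>. \<forall>j\<in>Field \<kappa>.
           ((i, j) \<in> \<kappa> \<longrightarrow> gtp K C (case_sum (a i) (b j)) M = p) \<and>
           ((j, i) \<in> \<kappa> \<and> i \<noteq> j \<longrightarrow> gtp K C (case_sum (a i) (b j)) M = q)))"


section \<open>Non-forking\<close>

definition nonforking ::
    "('f, 'r, 'a) aec \<Rightarrow> ('f, 'r, 'a) str \<Rightarrow> 'k rel \<Rightarrow> ('a \<rightharpoonup> 'a) \<Rightarrow>
     ('f, 'r, 'a) str \<Rightarrow> ('f, 'r, 'a) str \<Rightarrow> bool" where
  "nonforking K C \<kappa> A M0 N \<longleftrightarrow>
     (\<forall>J N'. J \<subseteq> dom A \<longrightarrow> |J| <o \<kappa> \<longrightarrow> prec K N' N \<longrightarrow> |univ N'| <o \<kappa> \<longrightarrow>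
        (\<exists>b. ran b \<subseteq> univ M0 \<and> b \<in> gtp K C (A |` J) N'))"

text \<open>Existence is required over models of cardinality at least \<open>\<kappa>\<close>. Over a smaller \<open>M0\<close> it would
  say that every element of the monster lies in \<open>M0\<close> (take \<open>M0\<close> itself as the small submodel),
  which is never the case.\<close>

definition nonforking_existence :: "('f, 'r, 'a) aec \<Rightarrow> ('f, 'r, 'a) str \<Rightarrow> 'k rel \<Rightarrow> bool" where
  "nonforking_existence K C \<kappa> \<longleftrightarrow>
     (\<forall>M0\<in>models K C. \<forall>I. \<forall>A\<in>seqs C I. \<kappa> \<le>o |univ M0| \<longrightarrow> nonforking K C \<kappa> A M0 M0)"

definition nonforking_extension :: "('f, 'r, 'a) aec \<Rightarrow> ('f, 'r, 'a) str \<Rightarrow> 'k rel \<Rightarrow> bool" where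
  "nonforking_extension K C \<kappa> \<longleftrightarrow>
     (\<forall>M0\<in>models K C. \<forall>N\<in>models K C. \<forall>N'\<in>models K C. \<forall>I. \<forall>A\<in>seqs C I.
        prec K M0 N \<longrightarrow> prec K N N' \<longrightarrow> nonforking K C \<kappa> A M0 N \<longrightarrow>
        (\<exists>A'\<in>seqs C I. gtp K C A' N = gtp K C A N \<and> nonforking K C \<kappa> A' M0 N'))"

text \<open>Non-forking over \<open>N\<close> is invariant under automorphisms fixing \<open>N\<close>, so one realization of
  the type decides.\<close>

definition forking_extension ::
    "('f, 'r, 'a) aec \<Rightarrow> ('f, 'r, 'a) str \<Rightarrow> 'k rel \<Rightarrow> ('f, 'r, 'a) str \<Rightarrow> ('a \<rightharpoonup> 'a) set \<Rightarrow>
     ('f, 'r, 'a) str \<Rightarrow> ('a \<rightharpoonup> 'a) set \<Rightarrow> bool" where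
  "forking_extension K C \<kappa> M p N q \<longleftrightarrow>
     prec K M N \<and> q \<in> gtypes K C N \<and> gtp_restrict K C q M = p \<and>
     (\<exists>A\<in>q. \<not> nonforking K C \<kappa> A M N)"


section \<open>Ranks\<close>

text \<open>Ordinals are the elements of an arbitrary well-ordered type \<open>'o\<close>, that is, the ordinals below
  an arbitrary ordinal; \<open>Pinf\<close> stands for \<open>\<infinity>\<close>. A statement about ranks that is polymorphic in \<open>'o\<close>
  is a statement about all ordinals.\<close>

definition is_zero :: "'o::wellorder \<Rightarrow> bool" where
  "is_zero \<alpha> \<longleftrightarrow> (\<forall>\<beta>. \<alpha> \<le> \<beta>)"

definition is_succ :: "'o::wellorder \<Rightarrow> 'o \<Rightarrow> bool" where
  "is_succ \<beta> \<alpha> \<longleftrightarrow> \<beta> < \<alpha> \<and> (\<forall>\<gamma>. \<beta> < \<gamma> \<longrightarrow> \<alpha> \<le> \<gamma>)"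

definition is_limit :: "'o::wellorder \<Rightarrow> bool" where
  "is_limit \<alpha> \<longleftrightarrow> \<not> is_zero \<alpha> \<and> (\<forall>\<beta>. \<not> is_succ \<beta> \<alpha>)"

definition rank_value :: "('o::wellorder \<Rightarrow> bool) \<Rightarrow> 'o extended" where
  "rank_value P = (if \<forall>\<alpha>. P \<alpha> then Pinf else Fin (GREATEST \<alpha>. P \<alpha>))"

inductive U_ge ::
    "('f, 'r, 'a) aec \<Rightarrow> ('f, 'r, 'a) str \<Rightarrow> 'k rel \<Rightarrow>
     ('f, 'r, 'a) str \<Rightarrow> ('a \<rightharpoonup> 'a) set \<Rightarrow> 'o::wellorder \<Rightarrow> bool"
  for K :: "('f, 'r, 'a) aec" and C :: "('f, 'r, 'a) str" and \<kappa> :: "'k rel" where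
  zero: "is_zero \<alpha> \<Longrightarrow> U_ge K C \<kappa> M p \<alpha>"
| limit: "is_limit \<alpha> \<Longrightarrow> (\<And>\<beta>. \<beta> < \<alpha> \<Longrightarrow> U_ge K C \<kappa> M p \<beta>) \<Longrightarrow> U_ge K C \<kappa> M p \<alpha>"
| succ: "is_succ \<beta> \<alpha> \<Longrightarrow> M' \<in> models K C \<Longrightarrow> |univ M'| =o |univ M| \<Longrightarrow>
    forking_extension K C \<kappa> M p M' p' \<Longrightarrow> U_ge K C \<kappa> M' p' \<beta> \<Longrightarrow> U_ge K C \<kappa> M p \<alpha>"

definition U_rank ::
    "('f, 'r, 'a) aec \<Rightarrow> ('f, 'r, 'a) str \<Rightarrow> 'k rel \<Rightarrow>
     ('f, 'r, 'a) str \<Rightarrow> ('a \<rightharpoonup> 'a) set \<Rightarrow> 'o::wellorder extended" where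
  "U_rank K C \<kappa> M p = rank_value (U_ge K C \<kappa> M p)"

text \<open>Rule \<open>large\<close> is the clause defining the rank of a type over a model of cardinality above
  \<open>\<lambda>\<close> as a minimum: the minimum is at least \<open>\<alpha>\<close> iff all its members are.\<close>

inductive R_ge ::
    "('f, 'r, 'a) aec \<Rightarrow> ('f, 'r, 'a) str \<Rightarrow> 'c rel \<Rightarrow>
     ('f, 'r, 'a) str \<Rightarrow> ('a \<rightharpoonup> 'a) set \<Rightarrow> 'o::wellorder \<Rightarrow> bool"
  for K :: "('f, 'r, 'a) aec" and C :: "('f, 'r, 'a) str" and lam :: "'c rel" where
  zero: "|univ M| =o lam \<Longrightarrow> is_zero \<alpha> \<Longrightarrow> R_ge K C lam M p \<alpha>"
| limit: "|univ M| =o lam \<Longrightarrow> is_limit \<alpha> \<Longrightarrow> (\<And>\<beta>. \<beta> < \<alpha> \<Longrightarrow> R_ge K C lam M p \<beta>) \<Longrightarrow>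
    R_ge K C lam M p \<alpha>"
| succ: "|univ M| =o lam \<Longrightarrow> is_succ \<beta> \<alpha> \<Longrightarrow> M' \<in> models K C \<Longrightarrow> prec K M M' \<Longrightarrow>
    inj_on P (Field (cardSuc lam)) \<Longrightarrow>
    (\<And>i. i \<in> Field (cardSuc lam) \<Longrightarrow>
      P i \<in> gtypes K C M' \<and> gtp_restrict K C (P i) M = p \<and> R_ge K C lam M' (P i) \<beta>) \<Longrightarrow>
    R_ge K C lam M p \<alpha>"
| large: "lam <o |univ M| \<Longrightarrow>
    (\<And>N. prec K N M \<Longrightarrow> |univ N| =o lam \<Longrightarrow> R_ge K C lam N (gtp_restrict K C p N) \<alpha>) \<Longrightarrow>
    R_ge K C lam M p \<alpha>"

definition R_rank ::
    "('f, 'r, 'a) aec \<Rightarrow> ('f, 'r, 'a) str \<Rightarrow> 'c rel \<Rightarrow>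
     ('f, 'r, 'a) str \<Rightarrow> ('a \<rightharpoonup> 'a) set \<Rightarrow> 'o::wellorder extended" where
  "R_rank K C lam M p = rank_value (R_ge K C lam M p)"

text \<open>The values are the intended ones: a rank is at least an ordinal \<open>\<alpha>\<close> iff the recursively defined
  relation holds at \<open>\<alpha>\<close>.\<close>

lemma is_zero_succ_limit: "is_zero \<alpha> \<or> (\<exists>\<beta>. is_succ \<beta> \<alpha>) \<or> is_limit \<alpha>"
  unfolding is_limit_def by blast

lemma rank_value_ge_iff:
  assumes zero: "\<And>\<alpha>. is_zero \<alpha> \<Longrightarrow> P \<alpha>"
    and limit: "\<And>\<alpha>. is_limit \<alpha> \<Longrightarrow> (\<And>\<beta>. \<beta> < \<alpha> \<Longrightarrow> P \<beta>) \<Longrightarrow> P \<alpha>"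
    and down: "\<And>\<alpha> \<beta>. P \<alpha> \<Longrightarrow> \<beta> < \<alpha> \<Longrightarrow> P \<beta>"
  shows "Fin \<alpha> \<le> rank_value P \<longleftrightarrow> P \<alpha>"
proof (cases "\<forall>\<alpha>. P \<alpha>")
  case True
  then show ?thesis by (simp add: rank_value_def)
next
  case False
  define \<delta> where "\<delta> = (LEAST \<alpha>. \<not> P \<alpha>)"
  have nd: "\<not> P \<delta>" unfolding \<delta>_def using False by (metis LeastI)
  have below: "P \<beta>" if "\<beta> < \<delta>" for \<beta> using that not_less_Least unfolding \<delta>_def by blast
  obtain \<beta> where b: "is_succ \<beta> \<delta>" using is_zero_succ_limit zero limit below nd by blast
  have pb: "P \<beta>" using below b by (simp add: is_succ_def)
  have up: "\<gamma> \<le> \<beta>" if "P \<gamma>" for \<gamma>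
    using that b nd down unfolding is_succ_def by (metis linorder_not_le order_le_less)
  have "(GREATEST \<alpha>. P \<alpha>) = \<beta>" using pb up by (rule Greatest_equality)
  then have "rank_value P = Fin \<beta>" using False by (simp add: rank_value_def)
  then show ?thesis using pb up down by (auto simp: order_le_less)
qed

lemma U_ge_down: "U_ge K C \<kappa> M p \<alpha> \<Longrightarrow> \<beta> < \<alpha> \<Longrightarrow> U_ge K C \<kappa> M p \<beta>"
proof -
  have "\<forall>\<beta><\<alpha>. U_ge K C \<kappa> M p \<beta>" if "U_ge K C \<kappa> M p \<alpha>"
    using that
  proof (induction rule: U_ge.induct)
    case (zero \<alpha> M p)
    then show ?case by (auto simp: is_zero_def leD)
  next
    case (limit \<alpha> M p)
    then show ?case by blast
  next
    case (succ \<gamma> \<alpha> M' M p p')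
    have sub: "U_ge K C \<kappa> M' p' \<epsilon>" if "\<epsilon> \<le> \<gamma>" for \<epsilon>
      using succ.hyps(5) succ.IH that unfolding order_le_less by blast
    have "U_ge K C \<kappa> M p \<epsilon>" if "\<epsilon> \<le> \<gamma>" for \<epsilon>
      using that
    proof (induction \<epsilon> rule: less_induct)
      case (less \<epsilon>)
      consider "is_zero \<epsilon>" | \<eta> where "is_succ \<eta> \<epsilon>" | "is_limit \<epsilon>"
        using is_zero_succ_limit by blast
      then show ?case
      proof cases
        case 1
        then show ?thesis by (rule U_ge.zero)
      next
        case 2
        then have "\<eta> \<le> \<gamma>" using less.prems by (auto simp: is_succ_def)
        then show ?thesis using U_ge.succ[OF 2 succ.hyps(2-4) sub] by blast
      next
        case 3
        then show ?thesis using less.IH less.prems by (meson U_ge.limit less_le_trans less_imp_le)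
      qed
    qed
    moreover have "\<beta> \<le> \<gamma>" if "\<beta> < \<alpha>" for \<beta>
      using that succ.hyps(1) unfolding is_succ_def by (meson leD not_le_imp_less)
    ultimately show ?case by blast
  qed
  then show "U_ge K C \<kappa> M p \<alpha> \<Longrightarrow> \<beta> < \<alpha> \<Longrightarrow> U_ge K C \<kappa> M p \<beta>" by blast
qed

lemma U_rank_ge_iff: "Fin \<alpha> \<le> U_rank K C \<kappa> M p \<longleftrightarrow> U_ge K C \<kappa> M p \<alpha>"
  unfolding U_rank_def
proof (rule rank_value_ge_iff)
  show "U_ge K C \<kappa> M p \<beta>" if "is_zero \<beta>" for \<beta>
    using that by (rule U_ge.zero)
  show "U_ge K C \<kappa> M p \<beta>" if "is_limit \<beta>" "\<And>\<gamma>. \<gamma> < \<beta> \<Longrightarrow> U_ge K C \<kappa> M p \<gamma>" for \<beta>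
    using that by (rule U_ge.limit)
qed (rule U_ge_down)

lemma R_ge_down: "R_ge K C lam M p \<alpha> \<Longrightarrow> \<beta> < \<alpha> \<Longrightarrow> R_ge K C lam M p \<beta>"
proof -
  have "\<forall>\<beta><\<alpha>. R_ge K C lam M p \<beta>" if "R_ge K C lam M p \<alpha>"
    using that
  proof (induction rule: R_ge.induct)
    case (zero M \<alpha> p)
    then show ?case by (auto simp: is_zero_def leD)
  next
    case (limit M \<alpha> p)
    then show ?case by blast
  next
    case (succ M \<gamma> \<alpha> M' P p)
    have sub: "R_ge K C lam M' (P i) \<epsilon>" if "i \<in> Field (cardSuc lam)" "\<epsilon> \<le> \<gamma>" for i \<epsilon>
      using succ.IH[OF that(1)] that(2) by (auto simp: order_le_less)
    have "R_ge K C lam M p \<epsilon>" if "\<epsilon> \<le> \<gamma>" for \<epsilon>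
      using that
    proof (induction \<epsilon> rule: less_induct)
      case (less \<epsilon>)
      consider "is_zero \<epsilon>" | \<eta> where "is_succ \<eta> \<epsilon>" | "is_limit \<epsilon>"
        using is_zero_succ_limit by blast
      then show ?case
      proof cases
        case 1
        then show ?thesis using succ.hyps(1) by (blast intro: R_ge.zero)
      next
        case 2
        have "\<eta> \<le> \<gamma>" using 2 less.prems by (auto simp: is_succ_def)
        then show ?thesis using 2 succ.hyps succ.IH sub
          by (intro R_ge.succ[of M lam \<eta> \<epsilon> M' K C P p]) auto
      next
        case 3
        then show ?thesis
          using less.IH less.prems succ.hyps(1) by (meson R_ge.limit less_le_trans less_imp_le)
      qed
    qed
    moreover have "\<beta> \<le> \<gamma>" if "\<beta> < \<alpha>" for \<beta>
      using that succ.hyps(2) unfolding is_succ_def by (meson leD not_le_imp_less)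
    ultimately show ?case by blast
  next
    case (large M p \<alpha>)
    then show ?case by (blast intro: R_ge.large)
  qed
  then show "R_ge K C lam M p \<alpha> \<Longrightarrow> \<beta> < \<alpha> \<Longrightarrow> R_ge K C lam M p \<beta>" by blast
qed

lemma R_ge_large_iff:
  assumes "lam <o |univ M|"
  shows "R_ge K C lam M p \<alpha> \<longleftrightarrow>
    (\<forall>N. prec K N M \<longrightarrow> |univ N| =o lam \<longrightarrow> R_ge K C lam N (gtp_restrict K C p N) \<alpha>)"
proof -
  have "\<not> |univ M| =o lam" using assms not_ordLess_ordIso ordIso_symmetric by blast
  then show ?thesis using assms by (metis R_ge.simps)
qed

lemma R_rank_ge_iff:
  assumes "|univ M| =o lam \<or> lam <o |univ M|"
  shows "Fin \<alpha> \<le> R_rank K C lam M p \<longleftrightarrow> R_ge K C lam M p \<alpha>"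
  unfolding R_rank_def
proof (rule rank_value_ge_iff)
  show "R_ge K C lam M p \<beta>" if "is_zero \<beta>" for \<beta>
    using assms that R_ge_large_iff R_ge.zero by metis
  show "R_ge K C lam M p \<beta>" if "is_limit \<beta>" "\<And>\<gamma>. \<gamma> < \<beta> \<Longrightarrow> R_ge K C lam M p \<gamma>" for \<beta>
  proof (cases "|univ M| =o lam")
    case True
    then show ?thesis using that by (blast intro: R_ge.limit)
  next
    case False
    then have "lam <o |univ M|" using assms by blast
    then show ?thesis using that R_ge.limit[OF _ that(1)]
      unfolding R_ge_large_iff[OF \<open>lam <o |univ M|\<close>] by blast
  qed
qed (rule R_ge_down)

end

theory Submission
  imports Defs
begin

text \<open>If \<open>R[p] \<ge> \<beta> + 1\<close>, then \<open>p\<close> has two distinct extensions \<open>p\<^sub>i\<close> of \<open>R\<close>-rank at least \<open>\<beta>\<close>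
  over one model \<open>M'\<close>. Non-forking extensions are unique, so one of them forks over \<open>M\<close>; forking
  is witnessed by a small submodel, so this extension still forks over \<open>M\<close> after restriction to a
  model of size \<open>\<lambda>\<close>, and restricting does not lower its \<open>R\<close>-rank. Uniqueness follows from the failure of the order property, which makes the
  coheir relation symmetric.\<close>

section \<open>Cardinals\<close>

text \<open>The disjoint sum dominates both factors and stays below \<open>r\<close>. If it is
  infinite it also dominates the product; if it is finite, so is the product. Thus the bound stays
  strict even for singular \<open>r\<close>.\<close>

lemma card_of_Times_ordLess_Cinfinite:
  assumes r: "Cinfinite r" and A: "|A| <o r" and B: "|B| <o r"
  shows "|A \<times> B| <o r"
proof -
  let ?D = "A <+> B"
  have D: "|?D| <o r"
    using card_of_Plus_ordLess_infinite_Field[of r A B] assms by (simp add: cinfinite_def)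
  show ?thesis
  proof (cases "finite ?D")
    case True
    then have "finite (A \<times> B)" by (simp add: finite_Plus_iff)
    then show ?thesis
      using r Cfinite_ordLess_Cinfinite[of "|A \<times> B|" r]
      by (simp add: cfinite_def Field_card_of card_of_card_order_on)
  next
    case False
    have "|A \<times> B| \<le>o |?D|"
      using False card_of_Times_ordLeq_infinite_Field[of "|?D|" A B]
      by (simp add: Field_card_of card_of_card_order_on card_of_Plus1 card_of_Plus2)
    then show ?thesis using D by (rule ordLeq_ordLess_trans)
  qed
qed

lemma card_of_ran: "|ran b| \<le>o |dom b|"
proof -
  have "ran b = (the \<circ> b) ` dom b" by (force simp: ran_def dom_def)
  then show ?thesis by (metis card_of_image)
qed

text \<open>The common index set \<open>J\<close> makes the union an image of
  \<open>S \<times> J\<close>. Separate bounds on the ranges would not do for singular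
  \<open>r\<close>, where fewer than \<open>r\<close> sets of size below \<open>r\<close> can have a
  union of size \<open>r\<close>.\<close>

lemma card_of_UNION_ran_ordLess:
  assumes r: "Cinfinite r" and S: "|S| <o r" and J: "|J| <o r"
    and dom: "\<And>j. j \<in> S \<Longrightarrow> dom (f j) = J"
  shows "|\<Union>j\<in>S. ran (f j)| <o r"
proof -
  have "(\<Union>j\<in>S. ran (f j)) \<subseteq> (\<lambda>(j, x). the (f j x)) ` (S \<times> J)"
  proof
    fix y assume "y \<in> (\<Union>j\<in>S. ran (f j))"
    then obtain j x where "j \<in> S" "f j x = Some y" by (auto simp: ran_def)
    moreover from this have "x \<in> J" using dom by blast
    ultimately show "y \<in> (\<lambda>(j, x). the (f j x)) ` (S \<times> J)" by force
  qed
  then have "|\<Union>j\<in>S. ran (f j)| \<le>o |S \<times> J|"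
    by (meson card_of_image card_of_mono1 ordLeq_transitive)
  then show ?thesis
    using card_of_Times_ordLess_Cinfinite[OF r S J] by (rule ordLeq_ordLess_trans)
qed

lemma csum_ordLess_Cinfinite:
  assumes "Cinfinite r" and "|A| <o r" and "ls <o r" and "Card_order ls"
  shows "|A| +c ls <o r"
proof -
  have "|Field ls| <o r" using assms(3,4) card_of_Field_ordIso ordIso_ordLess_trans by blast
  then show ?thesis
    unfolding csum_def Field_card_of
    using assms card_of_Plus_ordLess_infinite_Field[of r A "Field ls"]
    by (simp add: cinfinite_def)
qed


section \<open>Automorphisms and Galois types\<close>

text \<open>In contrast to \<open>aut_over\<close>, any set may be fixed, so ranges of sequences can
  be added to the parameters without first closing them to a model.\<close>

definition auts_fixing ::
    "('f, 'r, 'a) aec \<Rightarrow> ('f, 'r, 'a) str \<Rightarrow> 'a set \<Rightarrow> ('a \<Rightarrow> 'a) set" where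
  "auts_fixing K C X = {h. isomorphism (voc K) C C h \<and> (\<forall>x\<in>X. h x = x)}"

lemma aut_over_eq: "aut_over K C M = auts_fixing K C (univ M)"
  by (simp add: aut_over_def auts_fixing_def)

lemma auts_fixing_mono: "h \<in> auts_fixing K C X \<Longrightarrow> Y \<subseteq> X \<Longrightarrow> h \<in> auts_fixing K C Y"
  by (auto simp: auts_fixing_def)

lemma auts_fixing_bij: "h \<in> auts_fixing K C X \<Longrightarrow> bij_betw h (univ C) (univ C)"
  by (simp add: auts_fixing_def isomorphism_def)

lemma map_in_args:
  assumes "h ` univ C \<subseteq> univ C" and "xs \<in> args C n"
  shows "map h xs \<in> args C n"
  using assms by (auto simp: args_def)

lemma auts_fixing_comp:
  assumes h: "h \<in> auts_fixing K C X" and g: "g \<in> auts_fixing K C X"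
  shows "g \<circ> h \<in> auts_fixing K C X"
proof -
  have "h ` univ C \<subseteq> univ C" using auts_fixing_bij[OF h] by (simp add: bij_betw_def)
  note m = map_in_args[OF this]
  have "bij_betw (g \<circ> h) (univ C) (univ C)"
    using auts_fixing_bij[OF h] auts_fixing_bij[OF g] by (rule bij_betw_trans)
  moreover have "(g \<circ> h) (fint C s xs) = fint C s (map (g \<circ> h) xs)"
    if "s \<in> fsyms (voc K)" "xs \<in> args C (farity (voc K) s)" for s xs
    using h g m[OF that(2)] that by (simp add: auts_fixing_def isomorphism_def)
  moreover have "xs \<in> rint C s \<longleftrightarrow> map (g \<circ> h) xs \<in> rint C s"
    if "s \<in> rsyms (voc K)" "xs \<in> args C (rarity (voc K) s)" for s xs
  proof -
    have "xs \<in> rint C s \<longleftrightarrow> map h xs \<in> rint C s"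
      using h that by (simp add: auts_fixing_def isomorphism_def)
    also have "\<dots> \<longleftrightarrow> map g (map h xs) \<in> rint C s"
      using g that(1) m[OF that(2)] unfolding auts_fixing_def isomorphism_def by blast
    finally show ?thesis by simp
  qed
  ultimately show ?thesis using h g by (simp add: auts_fixing_def isomorphism_def)
qed

text \<open>An automorphism is a total function constrained only on \<open>univ C\<close>, so its
  inverse is \<open>inv_into (univ C) h\<close>, and the cancellation laws hold on
  \<open>univ C\<close> only.\<close>

lemma auts_fixing_inverse:
  assumes h: "h \<in> auts_fixing K C X" and X: "X \<subseteq> univ C"
  obtains g where "g \<in> auts_fixing K C X"
    and "\<And>x. x \<in> univ C \<Longrightarrow> g (h x) = x" and "\<And>x. x \<in> univ C \<Longrightarrow> h (g x) = x"
    and "\<And>x. x \<in> univ C \<Longrightarrow> g x \<in> univ C"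
proof -
  let ?g = "inv_into (univ C) h"
  have b: "bij_betw h (univ C) (univ C)" by (rule auts_fixing_bij[OF h])
  have bg: "bij_betw ?g (univ C) (univ C)" using b by (rule bij_betw_inv_into)
  have gh: "?g (h x) = x" if "x \<in> univ C" for x
    using b that by (simp add: bij_betw_inv_into_left)
  have hg: "h (?g x) = x" if "x \<in> univ C" for x
    using b that by (simp add: bij_betw_inv_into_right)
  have gC: "?g ` univ C \<subseteq> univ C" using bg by (simp add: bij_betw_def)
  have hgl: "map h (map ?g xs) = xs" if "xs \<in> args C n" for xs n
    using that hg by (auto simp: args_def intro!: map_idI)
  have "?g (fint C s xs) = fint C s (map ?g xs)"
    if s: "s \<in> fsyms (voc K)" and xs: "xs \<in> args C (farity (voc K) s)" for s xs
  proof -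
    have g: "map ?g xs \<in> args C (farity (voc K) s)" using gC xs by (rule map_in_args)
    then have "h (fint C s (map ?g xs)) = fint C s xs"
      using h s hgl[OF xs] unfolding auts_fixing_def isomorphism_def by force
    moreover have "fint C s (map ?g xs) \<in> univ C"
      using h s g unfolding auts_fixing_def isomorphism_def is_structure_def by blast
    ultimately show ?thesis using gh by metis
  qed
  moreover have "xs \<in> rint C s \<longleftrightarrow> map ?g xs \<in> rint C s"
    if s: "s \<in> rsyms (voc K)" and xs: "xs \<in> args C (rarity (voc K) s)" for s xs
  proof -
    have "map ?g xs \<in> args C (rarity (voc K) s)" using gC xs by (rule map_in_args)
    then show ?thesis
      using h s hgl[OF xs] unfolding auts_fixing_def isomorphism_def by force
  qed
  moreover have "\<forall>x\<in>X. ?g x = x"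
    using h X gh unfolding auts_fixing_def by (metis (mono_tags, lifting) mem_Collect_eq subsetD)
  ultimately have "?g \<in> auts_fixing K C X"
    using h bg unfolding auts_fixing_def isomorphism_def by simp
  then show ?thesis using that gh hg gC by blast
qed

lemma map_option_comp_id_on:
  assumes "\<And>x. x \<in> ran a \<Longrightarrow> h x = x"
  shows "map_option h \<circ> a = a"
proof
  fix i show "(map_option h \<circ> a) i = a i"
    using assms by (cases "a i") (auto intro: ranI)
qed

lemma ran_map_option_comp: "ran (map_option h \<circ> a) = h ` ran a"
  by (force simp: ran_def)

lemma map_option_comp_case_sum:
  "map_option h \<circ> case_sum a b = case_sum (map_option h \<circ> a) (map_option h \<circ> b)"
  by (auto simp: fun_eq_iff split: sum.splits)

lemma map_option_comp_restrict: "(map_option h \<circ> a) |` J = map_option h \<circ> (a |` J)"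
  by (auto simp: fun_eq_iff restrict_map_def)

lemma ran_case_sum: "ran (case_sum a b) = ran a \<union> ran b"
proof (rule set_eqI)
  fix y
  have "y \<in> ran (case_sum a b) \<longleftrightarrow> (\<exists>x. a x = Some y) \<or> (\<exists>x. b x = Some y)"
    unfolding ran_def by (simp add: split_sum_ex)
  then show "y \<in> ran (case_sum a b) \<longleftrightarrow> y \<in> ran a \<union> ran b" by (simp add: ran_def)
qed

lemma dom_case_sum: "dom (case_sum a b) = dom a <+> dom b"
proof (rule set_eqI)
  fix x show "x \<in> dom (case_sum a b) \<longleftrightarrow> x \<in> dom a <+> dom b" by (cases x) auto
qed

text \<open>A Galois type is an orbit, so composing with \<open>h\<close> or with its inverse does
  not leave it. The range of \<open>a\<close> lies in \<open>univ C\<close>, where the inverse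
  really undoes \<open>h\<close>.\<close>

lemma gtp_aut_image:
  assumes h: "h \<in> auts_fixing K C (univ M)" and M: "univ M \<subseteq> univ C" and a: "ran a \<subseteq> univ C"
  shows "gtp K C (map_option h \<circ> a) M = gtp K C a M"
proof -
  obtain g where g: "g \<in> auts_fixing K C (univ M)" "\<And>x. x \<in> univ C \<Longrightarrow> g (h x) = x"
    using auts_fixing_inverse[OF h M] by metis
  have factor: "map_option k \<circ> a = map_option (k \<circ> g) \<circ> (map_option h \<circ> a)" for k
  proof
    fix i show "(map_option k \<circ> a) i = (map_option (k \<circ> g) \<circ> (map_option h \<circ> a)) i"
      using a g(2) by (cases "a i") (auto dest: ranI[of a i])
  qed
  show ?thesis
  proof
    show "gtp K C (map_option h \<circ> a) M \<subseteq> gtp K C a M"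
    proof
      fix c assume "c \<in> gtp K C (map_option h \<circ> a) M"
      then obtain k where "k \<in> auts_fixing K C (univ M)" "c = map_option (k \<circ> h) \<circ> a"
        by (auto simp: gtp_def aut_over_eq comp_assoc[symmetric] option.map_comp fun_eq_iff)
      then show "c \<in> gtp K C a M"
        using auts_fixing_comp[OF h] unfolding gtp_def aut_over_eq by blast
    qed
    show "gtp K C a M \<subseteq> gtp K C (map_option h \<circ> a) M"
    proof
      fix c assume "c \<in> gtp K C a M"
      then obtain k where k: "k \<in> auts_fixing K C (univ M)" "c = map_option k \<circ> a"
        by (auto simp: gtp_def aut_over_eq)
      then show "c \<in> gtp K C (map_option h \<circ> a) M"
        using auts_fixing_comp[OF g(1) k(1)] factor[of k] unfolding gtp_def aut_over_eq by blast
    qed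
  qed
qed

lemma gtp_refl:
  assumes "C \<in> mods K" and "\<And>M. M \<in> mods K \<Longrightarrow> is_structure (voc K) M"
  shows "a \<in> gtp K C a M"
proof -
  have "id \<in> auts_fixing K C (univ M)"
    using assms by (simp add: auts_fixing_def isomorphism_def)
  moreover have "a = map_option id \<circ> a" by (simp add: option.map_id0)
  ultimately show ?thesis unfolding gtp_def aut_over_eq by blast
qed


section \<open>The order property and uniqueness of non-forking extensions\<close>

text \<open>A form of non-forking over sets, for sequences of length less than \<open>\<kappa>\<close>. In contrast to
  non-forking over models it can be transported along automorphisms without forming images of
  structures.\<close>

definition small_realized ::
    "('f, 'r, 'a) aec \<Rightarrow> ('f, 'r, 'a) str \<Rightarrow> 'k rel \<Rightarrow> ('i \<rightharpoonup> 'a) \<Rightarrow>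
     ('f, 'r, 'a) str \<Rightarrow> 'a set \<Rightarrow> bool" where
  "small_realized K C \<kappa> a M0 Y \<longleftrightarrow>
     (\<forall>X\<subseteq>Y. |X| <o \<kappa> \<longrightarrow>
        (\<exists>h\<in>auts_fixing K C X. ran (map_option h \<circ> a) \<subseteq> univ M0))"

lemma small_realized_aut_image:
  assumes f: "f \<in> auts_fixing K C (univ M0)" and M0: "univ M0 \<subseteq> univ C"
    and Y: "Y \<subseteq> univ C" and a: "ran a \<subseteq> univ C" and sr: "small_realized K C \<kappa> a M0 Y"
  shows "small_realized K C \<kappa> (map_option f \<circ> a) M0 (f ` Y)"
  unfolding small_realized_def
proof (intro allI impI)
  fix X assume X: "X \<subseteq> f ` Y" "|X| <o \<kappa>"
  obtain g where g: "g \<in> auts_fixing K C (univ M0)" "\<And>x. x \<in> univ C \<Longrightarrow> g (f x) = x"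
    "\<And>x. x \<in> univ C \<Longrightarrow> f (g x) = x"
    using auts_fixing_inverse[OF f M0] by metis
  have "g ` X \<subseteq> Y" using X(1) Y g(2) by force
  moreover have "|g ` X| <o \<kappa>" using X(2) card_of_image ordLeq_ordLess_trans by blast
  ultimately obtain h where h: "h \<in> auts_fixing K C (g ` X)" "ran (map_option h \<circ> a) \<subseteq> univ M0"
    using sr unfolding small_realized_def by blast
  have iso: "f \<in> auts_fixing K C {}" "g \<in> auts_fixing K C {}" "h \<in> auts_fixing K C {}"
    using f g(1) h(1) by (auto intro: auts_fixing_mono)
  have "f \<circ> (h \<circ> g) \<in> auts_fixing K C {}" using iso by (intro auts_fixing_comp)
  moreover have XC: "X \<subseteq> univ C" using X(1) Y auts_fixing_bij[OF f] by (auto simp: bij_betw_def)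
  ultimately have "f \<circ> (h \<circ> g) \<in> auts_fixing K C X"
    using h(1) g(3) by (auto simp: auts_fixing_def)
  moreover have "ran (map_option (f \<circ> (h \<circ> g)) \<circ> (map_option f \<circ> a)) \<subseteq> univ M0"
  proof -
    have "(f \<circ> (h \<circ> g)) (f x) \<in> univ M0" if x: "x \<in> ran a" for x
    proof -
      have "h x \<in> univ M0" using h(2) x by (auto simp: ran_map_option_comp)
      moreover have "g (f x) = x" using x a g(2) by blast
      ultimately show ?thesis using f by (simp add: auts_fixing_def)
    qed
    then show ?thesis by (auto simp: ran_map_option_comp)
  qed
  ultimately show "\<exists>h\<in>auts_fixing K C X. ran (map_option h \<circ> (map_option f \<circ> a)) \<subseteq> univ M0"
    by blast
qed

text \<open>If the two types differed, realizing \<open>a\<close> over \<open>b\<close> and the earlier \<open>b\<^sub>j\<close>, and \<open>b'\<close> over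
  \<open>a\<close> and the earlier \<open>a\<^sub>j\<close>, alternately inside \<open>M0\<close> would produce the order property.\<close>

lemma gtp_pair_eq_of_no_order_property:
  fixes K :: "('f, 'r, 'a) aec" and C M0 M1 :: "('f, 'r, 'a) str" and \<kappa> :: "'k rel"
    and a b b' :: "'a \<rightharpoonup> 'a"
  assumes inf: "Cinfinite \<kappa>" and \<kappa>C: "\<kappa> \<le>o |univ C|"
    and nop: "\<not> weak_order_property K C \<kappa>"
    and a: "ran a \<subseteq> univ C" "|dom a| <o \<kappa>"
    and b: "ran b \<subseteq> univ C" "|dom b| <o \<kappa>"
    and M1: "M1 \<in> models K C" "univ M1 \<subseteq> univ M0" "|univ M1| <o \<kappa>"
    and M0: "univ M0 \<subseteq> univ C"
    and h: "h \<in> auts_fixing K C (univ M0)" and b': "b' = map_option h \<circ> b"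
    and sra: "small_realized K C \<kappa> a M0 (univ M0 \<union> ran b)"
    and srb: "small_realized K C \<kappa> b' M0 (univ M0 \<union> ran a)"
  shows "gtp K C (case_sum a b) M1 = gtp K C (case_sum a b') M1"
proof (rule ccontr)
  let ?tp = "\<lambda>x y. gtp K C (case_sum x y) M1"
  assume ne: "?tp a b \<noteq> ?tp a b'"
  have wo: "Well_order \<kappa>" using inf by (simp add: card_order_on_def)
  have M1C: "univ M1 \<subseteq> univ C" using M1(2) M0 by blast
  have hM1: "h \<in> auts_fixing K C (univ M1)" using h M1(2) by (rule auts_fixing_mono)
  have b'C: "ran b' \<subseteq> univ C"
    using b(1) auts_fixing_bij[OF h] by (auto simp: b' ran_map_option_comp bij_betw_def)
  have domb': "dom b' = dom b" by (simp add: b' dom_map_option_comp)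
  have move: "?tp (map_option k \<circ> x) (map_option k \<circ> y) = ?tp x y"
    if "k \<in> auts_fixing K C (univ M1)" "ran x \<subseteq> univ C" "ran y \<subseteq> univ C"
    for k and x y :: "'a \<rightharpoonup> 'a"
    using gtp_aut_image[OF that(1) M1C, of "case_sum x y"] that
    by (simp add: map_option_comp_case_sum ran_case_sum)
  define R where "R = \<kappa> - Id"
  \<comment> \<open>\<open>c\<close> is the candidate for the pair (a_i, b_i). Besides the order
    pattern, \<open>P\<close> records the types of its components with the original \<open>b\<close>
    and \<open>a\<close>; later stages compute the new types from these. Outside
    \<open>Field \<kappa>\<close> it is vacuous, since the choice principle runs over the whole
    index type.\<close>
  define P where "P f i c \<longleftrightarrow> (i \<in> Field \<kappa> \<longrightarrow>
      dom (fst c) = dom a \<and> ran (fst c) \<subseteq> univ M0 \<and> dom (snd c) = dom b \<and> ran (snd c) \<subseteq> univ M0 \<and>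
      ?tp (fst c) b = ?tp a b \<and> ?tp a (snd c) = ?tp a b' \<and> ?tp (fst c) (snd c) = ?tp a b \<and>
      (\<forall>j. (j, i) \<in> R \<longrightarrow> ?tp (fst c) (snd (f j)) = ?tp a b' \<and> ?tp (fst (f j)) (snd c) = ?tp a b))"
    for f :: "'k \<Rightarrow> ('a \<rightharpoonup> 'a) \<times> ('a \<rightharpoonup> 'a)" and i c
  have "\<exists>f. \<forall>i. P f i (f i)"
  proof (rule dependent_wf_choice[where R = R])
    show "wf R" using wo by (simp add: R_def well_order_on_def)
  next
    fix f g :: "'k \<Rightarrow> ('a \<rightharpoonup> 'a) \<times> ('a \<rightharpoonup> 'a)" and i c
    assume "\<And>z. (z, i) \<in> R \<Longrightarrow> f z = g z"
    then show "P f i c = P g i c" unfolding P_def by auto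
  next
    fix i and f :: "'k \<Rightarrow> ('a \<rightharpoonup> 'a) \<times> ('a \<rightharpoonup> 'a)"
    assume IH: "\<And>j. (j, i) \<in> R \<Longrightarrow> P f j (f j)"
    show "\<exists>c. P f i c"
    proof (cases "i \<in> Field \<kappa>")
      case False
      then show ?thesis by (simp add: P_def)
    next
      case True
      let ?S = "underS \<kappa> i"
      have S: "j \<in> ?S \<longleftrightarrow> (j, i) \<in> R" for j by (auto simp: underS_def R_def)
      have cS: "|?S| <o \<kappa>" using inf True by (simp add: card_of_underS)
      have prev: "dom (fst (f j)) = dom a \<and> ran (fst (f j)) \<subseteq> univ M0 \<and>
          dom (snd (f j)) = dom b \<and> ran (snd (f j)) \<subseteq> univ M0 \<and>
          ?tp (fst (f j)) b = ?tp a b \<and> ?tp a (snd (f j)) = ?tp a b'" if "j \<in> ?S" for j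
      proof -
        have "j \<in> Field \<kappa>" using that by (auto simp: underS_def intro: FieldI1)
        then show ?thesis using IH[of j] that by (simp add: S P_def)
      qed
      have small: "|\<Union>j\<in>?S. ran (fst (f j))| <o \<kappa>" "|\<Union>j\<in>?S. ran (snd (f j))| <o \<kappa>"
        by (rule card_of_UNION_ran_ordLess[OF inf cS a(2)], use prev in blast)
          (rule card_of_UNION_ran_ordLess[OF inf cS b(2)], use prev in blast)
      have ran_small: "|ran x| <o \<kappa>" if "|dom x| <o \<kappa>" for x :: "'a \<rightharpoonup> 'a"
        using card_of_ran that by (rule ordLeq_ordLess_trans)
      \<comment> \<open>The parameters that \<open>k\<close> has to fix when it moves
        \<open>a\<close> into \<open>M0\<close>: then \<open>ai\<close> has over \<open>M1\<close>
        the same type as \<open>a\<close>, jointly with \<open>b\<close> and with every earlier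
        second component.\<close>
      let ?X = "univ M1 \<union> (ran b \<union> (\<Union>j\<in>?S. ran (snd (f j))))"
      have "|?X| <o \<kappa>"
        by (intro Un_Cinfinite_bound_strict ran_small inf M1(3) small b(2))
      moreover have "?X \<subseteq> univ M0 \<union> ran b" using M1(2) prev by blast
      ultimately obtain k where k: "k \<in> auts_fixing K C ?X" "ran (map_option k \<circ> a) \<subseteq> univ M0"
        using sra unfolding small_realized_def by blast
      define ai where "ai = map_option k \<circ> a"
      have aiM: "ran ai \<subseteq> univ M0" and domai: "dom ai = dom a"
        using k(2) by (simp_all add: ai_def dom_map_option_comp)
      have kM1: "k \<in> auts_fixing K C (univ M1)" using k(1) by (rule auts_fixing_mono) simp
      have ai_tp: "?tp ai y = ?tp a y" if "ran y \<subseteq> ?X" "ran y \<subseteq> univ C"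
        for y :: "'a \<rightharpoonup> 'a"
      proof -
        have "map_option k \<circ> y = y"
          using k(1) that by (intro map_option_comp_id_on) (auto simp: auts_fixing_def)
        then show ?thesis using move[OF kM1 a(1) that(2)] by (simp add: ai_def)
      qed
      \<comment> \<open>\<open>ran ai\<close> is included, so that \<open>bi\<close> is chosen after
        \<open>ai\<close> and the diagonal pair falls under the same pattern as the pairs with i <
        j.\<close>
      let ?Y = "univ M1 \<union> (ran a \<union> (ran ai \<union> (\<Union>j\<in>?S. ran (fst (f j)))))"
      have "|?Y| <o \<kappa>"
        by (intro Un_Cinfinite_bound_strict ran_small inf M1(3) small a(2))
          (simp add: domai a(2))
      moreover have "?Y \<subseteq> univ M0 \<union> ran a" using M1(2) prev aiM by blast
      ultimately obtain l where l: "l \<in> auts_fixing K C ?Y" "ran (map_option l \<circ> b') \<subseteq> univ M0"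
        using srb unfolding small_realized_def by blast
      define bi where "bi = map_option l \<circ> b'"
      have biM: "ran bi \<subseteq> univ M0" and dombi: "dom bi = dom b"
        using l(2) by (simp_all add: bi_def dom_map_option_comp domb')
      have lM1: "l \<in> auts_fixing K C (univ M1)" using l(1) by (rule auts_fixing_mono) simp
      have bi_tp: "?tp x bi = ?tp x b'" if "ran x \<subseteq> ?Y" "ran x \<subseteq> univ C"
        for x :: "'a \<rightharpoonup> 'a"
      proof -
        have "map_option l \<circ> x = x"
          using l(1) that by (intro map_option_comp_id_on) (auto simp: auts_fixing_def)
        then show ?thesis using move[OF lM1 that(2) b'C] by (simp add: bi_def)
      qed
      \<comment> \<open>\<open>h\<close> carries \<open>b\<close> to \<open>b'\<close> and fixes
        \<open>M0\<close>, so sequences inside \<open>M0\<close> cannot tell \<open>b\<close> from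
        \<open>b'\<close> over \<open>M1\<close>; only \<open>a\<close>, which may lie outside
        \<open>M0\<close>, can. This produces the two different types of the order pattern.\<close>
      have bb': "?tp x b' = ?tp x b" if "ran x \<subseteq> univ M0"
        for x :: "'a \<rightharpoonup> 'a"
      proof -
        have "map_option h \<circ> x = x"
          using h that by (intro map_option_comp_id_on) (auto simp: auts_fixing_def)
        then show ?thesis using move[OF hM1 _ b(1), of x] that M0 by (simp add: b')
      qed
      have ai_b: "?tp ai b = ?tp a b" using ai_tp[of b] b(1) by blast
      have "?tp a bi = ?tp a b'" using bi_tp[of a] a(1) by blast
      moreover have "?tp ai bi = ?tp a b" using bi_tp[of ai] bb'[OF aiM] ai_b aiM M0 by auto
      moreover have "?tp ai (snd (f j)) = ?tp a b'" if "j \<in> ?S" for j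
      proof -
        have "ran (snd (f j)) \<subseteq> ?X" using that by blast
        moreover have "ran (snd (f j)) \<subseteq> univ C" using prev[OF that] M0 by blast
        ultimately show ?thesis using ai_tp prev[OF that] by simp
      qed
      moreover have "?tp (fst (f j)) bi = ?tp a b" if "j \<in> ?S" for j
      proof -
        have "ran (fst (f j)) \<subseteq> ?Y" using that by blast
        moreover have "ran (fst (f j)) \<subseteq> univ C" using prev[OF that] M0 by blast
        ultimately show ?thesis using bi_tp bb'[of "fst (f j)"] prev[OF that] by simp
      qed
      ultimately have "P f i (ai, bi)"
        using ai_b aiM biM domai dombi by (simp add: P_def S)
      then show ?thesis by blast
    qed
  qed
  then obtain f where f: "\<And>i. P f i (f i)" by blast
  have infC: "infinite (univ C)"
    using inf \<kappa>C cinfinite_mono[of \<kappa> "|univ C|"] by (simp add: cinfinite_def Field_card_of)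
  have aC: "|dom a| <o |univ C|" and bC: "|dom b| <o |univ C|"
    using a(2) b(2) \<kappa>C ordLess_ordLeq_trans by blast+
  have abC: "|dom a <+> dom b| <o |univ C|"
    using infC aC bC by (rule card_of_Plus_ordLess_infinite)
  have fC: "fst (f i) \<in> seqs C (dom a)" "snd (f i) \<in> seqs C (dom b)" if "i \<in> Field \<kappa>" for i
    using f[of i] that M0 aC bC by (auto simp: P_def seqs_def)
  have in_types: "?tp a y \<in> gtypes_len K C (dom a <+> dom b) M1"
    if "ran y \<subseteq> univ C" "dom y = dom b" for y :: "'a \<rightharpoonup> 'a"
  proof -
    have "case_sum a y \<in> seqs C (dom a <+> dom b)"
      using that a(1) abC by (simp add: seqs_def ran_case_sum dom_case_sum)
    then show ?thesis unfolding gtypes_len_def by blast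
  qed
  have ord: "((i, j) \<in> \<kappa> \<longrightarrow> ?tp (fst (f i)) (snd (f j)) = ?tp a b) \<and>
      ((j, i) \<in> \<kappa> \<and> i \<noteq> j \<longrightarrow> ?tp (fst (f i)) (snd (f j)) = ?tp a b')"
    if "i \<in> Field \<kappa>" "j \<in> Field \<kappa>" for i j
    using f[of i] f[of j] that by (cases "i = j") (auto simp: P_def R_def)
  have "weak_order_property K C \<kappa>"
    unfolding weak_order_property_def
    by (rule exI[of _ "dom a"], rule exI[of _ "dom b"], rule exI[of _ M1],
        rule exI[of _ "?tp a b"], rule exI[of _ "?tp a b'"],
        rule exI[of _ "\<lambda>i. fst (f i)"], rule exI[of _ "\<lambda>i. snd (f i)"],
        intro conjI a(2) b(2) M1(1,3) in_types b(1) b'C domb' refl ne)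
      (use fC ord in blast)+
  then show False using nop by blast
qed

section \<open>Small submodels, restriction of types, and uniqueness of non-forking
  extensions\<close>

lemma AEC_D:
  assumes "AEC K ls"
  shows AEC_is_structure: "M \<in> mods K \<Longrightarrow> is_structure (voc K) M"
    and AEC_prec: "prec K M N \<Longrightarrow> M \<in> mods K \<and> N \<in> mods K \<and> substructure (voc K) M N"
    and AEC_prec_trans: "prec K M N \<Longrightarrow> prec K N P \<Longrightarrow> prec K M P"
    and AEC_coherence:
      "prec K M0 M2 \<Longrightarrow> prec K M1 M2 \<Longrightarrow> univ M0 \<subseteq> univ M1 \<Longrightarrow> prec K M0 M1"
proof -
  note ax = assms[unfolded AEC_def]
  show "M \<in> mods K \<Longrightarrow> is_structure (voc K) M"
    using ax[THEN conjunct1] by blast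
  show "prec K M N \<Longrightarrow> M \<in> mods K \<and> N \<in> mods K \<and> substructure (voc K) M N"
    using ax[THEN conjunct2, THEN conjunct1] by blast
  show "prec K M N \<Longrightarrow> prec K N P \<Longrightarrow> prec K M P"
    using ax[THEN conjunct2, THEN conjunct2, THEN conjunct2, THEN conjunct1] by blast
  show "prec K M0 M2 \<Longrightarrow> prec K M1 M2 \<Longrightarrow> univ M0 \<subseteq> univ M1 \<Longrightarrow> prec K M0 M1"
    using ax[THEN conjunct2, THEN conjunct2, THEN conjunct2, THEN conjunct2, THEN conjunct2,
        THEN conjunct2, THEN conjunct1] by blast
qed

lemma AEC_prec_mods: "AEC K ls \<Longrightarrow> prec K M N \<Longrightarrow> M \<in> mods K \<and> N \<in> mods K"
  using AEC_prec[of K ls M N] by simp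

lemma AEC_prec_univ: "AEC K ls \<Longrightarrow> prec K M N \<Longrightarrow> univ M \<subseteq> univ N"
  using AEC_prec[of K ls M N] by (simp add: substructure_def)

lemma AEC_LS_bound: "AEC K ls \<Longrightarrow> LS_bound K ls"
  by (simp add: AEC_def LS_number_def)

text \<open>Lowenheim-Skolem with a strict bound, for hulls smaller than \<open>\<kappa>\<close> or
  than the monster. The variant with a weak bound below supplies models of size
  \<open>lam\<close>.\<close>

lemma AEC_submodel_ordLess:
  assumes "AEC K ls" and "M \<in> mods K" and "A \<subseteq> univ M"
    and "Cinfinite r" and "|A| <o r" and "ls <o r"
  obtains N where "prec K N M" and "A \<subseteq> univ N" and "|univ N| <o r"
proof -
  have LS: "LS_bound K ls" using assms(1) by (rule AEC_LS_bound)
  then obtain N where N: "prec K N M" "A \<subseteq> univ N" "|univ N| \<le>o |A| +c ls"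
    using assms(2,3) unfolding LS_bound_def by blast
  moreover have "|A| +c ls <o r"
    using csum_ordLess_Cinfinite[OF assms(4-6)] LS by (simp add: LS_bound_def)
  ultimately show ?thesis using that ordLeq_ordLess_trans by blast
qed

lemma AEC_submodel_ordLeq:
  assumes "AEC K ls" and "M \<in> mods K" and "A \<subseteq> univ M"
    and "Cinfinite r" and "|A| \<le>o r" and "ls \<le>o r"
  obtains N where "prec K N M" and "A \<subseteq> univ N" and "|univ N| \<le>o r"
proof -
  have LS: "LS_bound K ls" using assms(1) by (rule AEC_LS_bound)
  then obtain N where N: "prec K N M" "A \<subseteq> univ N" "|univ N| \<le>o |A| +c ls"
    using assms(2,3) unfolding LS_bound_def by blast
  moreover have "|A| +c ls \<le>o r"
    using csum_cinfinite_bound[OF assms(5,6) card_of_Card_order _ assms(4)] LS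
    by (simp add: LS_bound_def)
  ultimately show ?thesis using that ordLeq_transitive by blast
qed

lemma models_prec:
  assumes "AEC K ls" and "N \<in> models K C" and "prec K M N"
  shows "M \<in> models K C"
proof -
  have "|univ M| \<le>o |univ N|" using AEC_prec_univ[OF assms(1,3)] by (rule card_of_mono1)
  then show ?thesis
    using assms AEC_prec_trans ordLeq_ordLess_trans unfolding models_def by blast
qed

lemma models_univ: "AEC K ls \<Longrightarrow> M \<in> models K C \<Longrightarrow> univ M \<subseteq> univ C"
  using AEC_prec_univ[of K ls M C] by (simp add: models_def)

lemma AEC_gtp_refl: "AEC K ls \<Longrightarrow> C \<in> mods K \<Longrightarrow> a \<in> gtp K C a M"
  by (rule gtp_refl) (simp_all add: AEC_is_structure)

text \<open>The union defining \<open>gtp_restrict\<close> collapses to a single orbit: two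
  realizations of a type over \<open>N\<close> are conjugate over \<open>N\<close>, hence over the
  smaller \<open>M\<close>.\<close>

lemma gtp_restrict_gtp:
  assumes "AEC K ls" and "C \<in> mods K" and "ran a \<subseteq> univ C"
    and "univ M \<subseteq> univ N" and "univ N \<subseteq> univ C"
  shows "gtp_restrict K C (gtp K C a N) M = gtp K C a M"
proof -
  have "gtp K C c M = gtp K C a M" if c: "c \<in> gtp K C a N" for c
  proof -
    obtain h where h: "h \<in> auts_fixing K C (univ N)" "c = map_option h \<circ> a"
      using c by (auto simp: gtp_def aut_over_eq)
    have "h \<in> auts_fixing K C (univ M)" using h(1) assms(4) by (rule auts_fixing_mono)
    then show ?thesis using gtp_aut_image assms(3-5) h(2) by blast
  qed
  then show ?thesis
    using AEC_gtp_refl[OF assms(1,2), of a N] unfolding gtp_restrict_def by blast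
qed

lemma gtp_subseq_gtp: "gtp_subseq (gtp K C a N) J = gtp K C (a |` J) N"
proof -
  have "gtp_subseq (gtp K C a N) J = {(map_option h \<circ> a) |` J | h. h \<in> aut_over K C N}"
    unfolding gtp_subseq_def gtp_def by blast
  then show ?thesis by (simp only: gtp_def map_option_comp_restrict)
qed

lemma gtp_eqD:
  assumes "AEC K ls" and "C \<in> mods K" and "gtp K C a M = gtp K C b M"
  obtains h where "h \<in> auts_fixing K C (univ M)" and "b = map_option h \<circ> a"
  using AEC_gtp_refl[OF assms(1,2), of b M] assms(3) that by (auto simp: gtp_def aut_over_eq)

text \<open>A small set \<open>X\<close> lies in a small submodel of \<open>N\<close>. The
  automorphism that realizes the type over this submodel inside \<open>M0\<close> fixes
  \<open>X\<close> as well.\<close>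

lemma nonforking_imp_small_realized:
  assumes "AEC K ls" and "Cinfinite \<kappa>" and "ls <o \<kappa>" and "N \<in> mods K"
    and nf: "nonforking K C \<kappa> A M0 N" and J: "J \<subseteq> dom A" "|J| <o \<kappa>"
  shows "small_realized K C \<kappa> (A |` J) M0 (univ N)"
  unfolding small_realized_def
proof (intro allI impI)
  fix X assume "X \<subseteq> univ N" "|X| <o \<kappa>"
  then obtain N' where N': "prec K N' N" "X \<subseteq> univ N'" "|univ N'| <o \<kappa>"
    using AEC_submodel_ordLess assms(1-4) by metis
  then obtain b where b: "ran b \<subseteq> univ M0" "b \<in> gtp K C (A |` J) N'"
    using nf J unfolding nonforking_def by blast
  then obtain h where h: "h \<in> auts_fixing K C (univ N')" "b = map_option h \<circ> (A |` J)"
    by (auto simp: gtp_def aut_over_eq)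
  have "h \<in> auts_fixing K C X" using h(1) N'(2) by (rule auts_fixing_mono)
  then show "\<exists>h\<in>auts_fixing K C X. ran (map_option h \<circ> A |` J) \<subseteq> univ M0"
    using h(2) b(1) by blast
qed

lemma small_realized_mono:
  "small_realized K C \<kappa> a M0 Y \<Longrightarrow> Z \<subseteq> Y \<Longrightarrow> small_realized K C \<kappa> a M0 Z"
  unfolding small_realized_def by blast

text \<open>An enumeration \<open>b\<close> of a small submodel over which the types differ has a copy \<open>b'\<close> that does
  not fork over \<open>M\<close> with respect to \<open>a\<close>. By the lemma on pairs, replacing \<open>b\<close> by \<open>b'\<close> does not
  change its type with \<open>a\<close>, and an automorphism over \<open>M\<close> carrying \<open>a\<close> to \<open>a'\<close> transports
  this to \<open>a'\<close>.\<close>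

lemma nonforking_unique:
  fixes K :: "('f, 'r, 'a) aec" and C M N :: "('f, 'r, 'a) str" and \<kappa> :: "'k rel"
    and A A' :: "'a \<rightharpoonup> 'a"
  assumes aec: "AEC K ls" and CK: "C \<in> mods K" and inf: "Cinfinite \<kappa>" and ls: "ls <o \<kappa>"
    and tame: "fully_tame K C \<kappa>" and short: "fully_type_short K C \<kappa>"
    and nop: "\<not> weak_order_property K C \<kappa>"
    and ex: "nonforking_existence K C \<kappa>" and ext: "nonforking_extension K C \<kappa>"
    and M: "M \<in> models K C" "\<kappa> \<le>o |univ M|"
    and N: "N \<in> models K C" and MN: "prec K M N"
    and A: "A \<in> seqs C I" and A': "A' \<in> seqs C I"
    and eq: "gtp K C A M = gtp K C A' M"
    and nf: "nonforking K C \<kappa> A M N" and nf': "nonforking K C \<kappa> A' M N"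
  shows "gtp K C A N = gtp K C A' N"
proof (rule ccontr)
  assume ne: "gtp K C A N \<noteq> gtp K C A' N"
  have NC: "univ N \<subseteq> univ C" and MC: "univ M \<subseteq> univ C" using aec N M(1) models_univ by blast+
  have AC: "ran A \<subseteq> univ C" and A'C: "ran A' \<subseteq> univ C" and domA: "dom A = I" and domA': "dom A' = I"
    using A A' by (simp_all add: seqs_def)
  have "gtp K C A N \<in> gtypes_len K C I N" "gtp K C A' N \<in> gtypes_len K C I N"
    using A A' unfolding gtypes_len_def by blast+
  \<comment> \<open>Tameness, and then type shortness over \<open>N0\<close>, localize the
    difference to a subsequence of length below \<open>\<kappa>\<close> over a model of size below
    \<open>\<kappa>\<close>, as the lemma on pairs requires.\<close>
  then obtain N0 where N0: "prec K N0 N" "|univ N0| <o \<kappa>"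
    and "gtp_restrict K C (gtp K C A N) N0 \<noteq> gtp_restrict K C (gtp K C A' N) N0"
    using tame N ne unfolding fully_tame_def by meson
  moreover have N0N: "univ N0 \<subseteq> univ N" using aec N0(1) by (rule AEC_prec_univ)
  ultimately have ne0: "gtp K C A N0 \<noteq> gtp K C A' N0"
    using gtp_restrict_gtp[OF aec CK _ _ NC] AC A'C by metis
  have N0m: "N0 \<in> models K C" using aec N N0(1) by (rule models_prec)
  have N0C: "univ N0 \<subseteq> univ C" using N0N NC by blast
  have "gtp K C A N0 \<in> gtypes_len K C I N0" "gtp K C A' N0 \<in> gtypes_len K C I N0"
    using A A' unfolding gtypes_len_def by blast+
  then obtain J where J: "J \<subseteq> I" "|J| <o \<kappa>"
    and "gtp_subseq (gtp K C A N0) J \<noteq> gtp_subseq (gtp K C A' N0) J"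
    using short N0m ne0 unfolding fully_type_short_def by meson
  define a a' where "a = A |` J" and "a' = A' |` J"
  have nea: "gtp K C a N0 \<noteq> gtp K C a' N0"
    using \<open>gtp_subseq _ _ \<noteq> _\<close> by (simp add: gtp_subseq_gtp a_def a'_def)
  have aC: "ran a \<subseteq> univ C" and a'C: "ran a' \<subseteq> univ C"
    using AC A'C by (auto simp: a_def a'_def ran_def restrict_map_def split: if_splits)
  have doma: "dom a = J" and doma': "dom a' = J"
    using J(1) domA domA' by (auto simp: a_def a'_def)
  obtain f where f: "f \<in> auts_fixing K C (univ M)" "A' = map_option f \<circ> A"
    using gtp_eqD[OF aec CK eq] .
  have fa: "a' = map_option f \<circ> a" by (simp add: a_def a'_def f(2) map_option_comp_restrict)
  have sra: "small_realized K C \<kappa> a M (univ N)" "small_realized K C \<kappa> a' M (univ N)"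
    using nonforking_imp_small_realized[OF aec inf ls _ nf, of J]
      nonforking_imp_small_realized[OF aec inf ls _ nf', of J]
      J domA domA' AEC_prec_mods[OF aec MN] by (simp_all add: a_def a'_def)
  have MltC: "|univ M| <o |univ C|" using M(1) by (simp add: models_def)
  have \<kappa>C: "\<kappa> <o |univ C|" using M(2) MltC by (rule ordLeq_ordLess_trans)
  have infC: "Cinfinite |univ C|"
    using inf cinfinite_mono[OF ordLess_imp_ordLeq[OF \<kappa>C]] by (simp add: card_of_card_order_on Field_card_of)

  \<comment> \<open>\<open>univ N0\<close> is enumerated by itself. With \<open>b\<close> as second
    component, a type of the pair over any model determines the type of \<open>a\<close> over
    \<open>N0\<close>.\<close>
  define b where "b = (Some |` univ N0 :: 'a \<rightharpoonup> 'a)"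
  have domb: "dom b = univ N0" by (auto simp: b_def)
  have ranb: "ran b = univ N0" by (auto simp: b_def ran_def restrict_map_def)
  have bs: "b \<in> seqs C (univ N0)"
    using N0m N0C by (simp add: seqs_def domb ranb models_def)
  have "|ran a| <o \<kappa>" using card_of_ran[of a] J(2) doma ordLeq_ordLess_trans by metis
  then have "|univ M \<union> ran a| <o |univ C|"
    using MltC infC \<kappa>C by (intro Un_Cinfinite_bound_strict) (auto intro: ordLess_transitive)
  moreover have "univ M \<union> ran a \<subseteq> univ C" using MC aC by blast
  moreover have "ls <o |univ C|" using ls \<kappa>C by (rule ordLess_transitive)
  \<comment> \<open>Extension speaks of models only, so \<open>ran a\<close> is enclosed in a model
    \<open>N1\<close> above \<open>M\<close>; non-forking over \<open>N1\<close> then gives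
    independence from \<open>a\<close>.\<close>
  ultimately obtain N1 where N1: "prec K N1 C" "univ M \<union> ran a \<subseteq> univ N1" "|univ N1| <o |univ C|"
    using AEC_submodel_ordLess[OF aec CK _ infC] by metis
  have N1m: "N1 \<in> models K C" using N1 by (simp add: models_def)
  have N1C: "univ N1 \<subseteq> univ C" using aec N1m by (rule models_univ)
  have MC': "prec K M C" using M(1) by (simp add: models_def)
  have MN1: "prec K M N1" using AEC_coherence[OF aec MC' N1(1)] N1(2) by blast
  have MM: "prec K M M" using AEC_coherence[OF aec MC' MC'] by blast
  \<comment> \<open>Existence applies because \<open>M\<close> has size at least
    \<open>\<kappa>\<close>.\<close>
  have "nonforking K C \<kappa> b M M" using ex M bs unfolding nonforking_existence_def by blast
  then obtain b' where b': "b' \<in> seqs C (univ N0)" "gtp K C b' M = gtp K C b M"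
    "nonforking K C \<kappa> b' M N1"
    using ext M(1) N1m bs MM MN1 unfolding nonforking_extension_def by blast
  obtain h where h: "h \<in> auts_fixing K C (univ M)" "b' = map_option h \<circ> b"
    using gtp_eqD[OF aec CK b'(2)[symmetric]] .
  have domb': "dom b' = univ N0" and b'C: "ran b' \<subseteq> univ C" using b'(1) by (simp_all add: seqs_def)
  have srb: "small_realized K C \<kappa> b' M (univ N1)"
  proof -
    have "b' |` univ N0 = b'" unfolding domb'[symmetric] by (auto simp: restrict_map_def fun_eq_iff domIff)
    then show ?thesis
      using nonforking_imp_small_realized[OF aec inf ls _ b'(3), of "univ N0"]
        domb' N0(2) AEC_prec_mods[OF aec N1(1)] by simp
  qed
  have srb': "small_realized K C \<kappa> (map_option f \<circ> b') M (f ` univ N1)"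
    using small_realized_aut_image[OF f(1) MC N1C b'C srb] .
  \<comment> \<open>The order property refers to types over a model smaller than
    \<open>\<kappa>\<close>. Any small submodel of \<open>M\<close> will do, because
    \<open>N0\<close> is already encoded in \<open>b\<close>.\<close>
  obtain M1 where M1: "prec K M1 M" "|univ M1| <o \<kappa>"
  proof -
    have "|{} :: 'a set| <o \<kappa>"
      using inf Cfinite_ordLess_Cinfinite[of "|{} :: 'a set|" \<kappa>]
      by (simp add: cfinite_def Field_card_of card_of_card_order_on)
    then show ?thesis
      using AEC_submodel_ordLess[OF aec _ _ inf _ ls, of M "{}"] AEC_prec_mods[OF aec MM] that
      by blast
  qed
  have M1m: "M1 \<in> models K C" using aec M(1) M1(1) by (rule models_prec)
  have M1M: "univ M1 \<subseteq> univ M" using aec M1(1) by (rule AEC_prec_univ)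
  have M1C: "univ M1 \<subseteq> univ C" using M1M MC by blast
  have MN': "univ M \<subseteq> univ N" using aec MN by (rule AEC_prec_univ)
  note pair = gtp_pair_eq_of_no_order_property[OF inf ordLess_imp_ordLeq[OF \<kappa>C] nop _ _ _ _
      M1m M1M M1(2) MC]
  have bC: "ran b \<subseteq> univ C" "|dom b| <o \<kappa>" using N0C N0(2) by (simp_all add: domb ranb)
  have "gtp K C (case_sum a b) M1 = gtp K C (case_sum a b') M1"
  proof (rule pair[OF aC _ bC h])
    show "|dom a| <o \<kappa>" using J(2) doma by simp
    show "small_realized K C \<kappa> a M (univ M \<union> ran b)"
      using sra(1) by (rule small_realized_mono) (use MN' N0N ranb in blast)
    show "small_realized K C \<kappa> b' M (univ M \<union> ran a)"
      using srb N1(2) by (rule small_realized_mono)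
  qed
  also have "\<dots> = gtp K C (map_option f \<circ> case_sum a b') M1"
    using gtp_aut_image[OF auts_fixing_mono[OF f(1) M1M] M1C, of "case_sum a b'"] aC b'C
    by (simp add: ran_case_sum)
  also have "\<dots> = gtp K C (case_sum a' (map_option f \<circ> b')) M1"
    by (simp add: map_option_comp_case_sum fa)
  \<comment> \<open>The same argument for \<open>a'\<close>, read backwards:
    \<open>map_option f \<circ> b'\<close> is a copy of \<open>b\<close> under
    \<open>f \<circ> h\<close>, which fixes \<open>M\<close>, and \<open>srb'\<close> gives its
    independence from \<open>a'\<close>.\<close>
  also have "\<dots> = gtp K C (case_sum a' b) M1"
  proof (rule pair[symmetric, OF a'C _ bC auts_fixing_comp[OF h(1) f(1)]])
    show "|dom a'| <o \<kappa>" using J(2) doma' by simp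
    show "map_option f \<circ> b' = map_option (f \<circ> h) \<circ> b"
      by (simp add: h(2) fun_eq_iff option.map_comp)
    show "small_realized K C \<kappa> a' M (univ M \<union> ran b)"
      using sra(2) by (rule small_realized_mono) (use MN' N0N ranb in blast)
    have "univ M \<subseteq> f ` univ N1" using f(1) N1(2) by (force simp: auts_fixing_def)
    moreover have "ran a' \<subseteq> f ` univ N1" using N1(2) by (auto simp: fa ran_map_option_comp)
    ultimately have "univ M \<union> ran a' \<subseteq> f ` univ N1" by (rule Un_least)
    with srb' show "small_realized K C \<kappa> (map_option f \<circ> b') M (univ M \<union> ran a')"
      by (rule small_realized_mono)
  qed
  finally have "gtp K C (case_sum a b) M1 = gtp K C (case_sum a' b) M1" .
  \<comment> \<open>Since \<open>g\<close> maps the enumeration \<open>b\<close> to itself, it fixes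
    \<open>N0\<close> pointwise; as it carries \<open>a\<close> to \<open>a'\<close>, the two agree
    over \<open>N0\<close>, against \<open>nea\<close>.\<close>
  then obtain g where g: "g \<in> auts_fixing K C (univ M1)"
    and "case_sum a' b = map_option g \<circ> case_sum a b"
    by (rule gtp_eqD[OF aec CK])
  then have "case_sum a' b = case_sum (map_option g \<circ> a) (map_option g \<circ> b)"
    by (simp only: map_option_comp_case_sum)
  then have ga: "a' = map_option g \<circ> a" and gb: "b = map_option g \<circ> b"
    by (auto elim: case_sum_inject)
  have "g x = x" if "x \<in> univ N0" for x
    using fun_cong[OF gb, of x] that by (simp add: b_def)
  then have "g \<in> auts_fixing K C (univ N0)" using g by (simp add: auts_fixing_def)
  from gtp_aut_image[OF this N0C aC] have "gtp K C a' N0 = gtp K C a N0" by (simp add: ga)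
  then show False using nea by simp
qed


section \<open>Comparison of the ranks\<close>

text \<open>The comparison is made at each \<alpha> separately and for all models of size
  \<open>lam\<close> at once, so that the induction hypothesis is available over the new model found
  at a successor.\<close>

lemma R_ge_imp_U_ge:
  fixes K :: "('f, 'r, 'a) aec" and C M :: "('f, 'r, 'a) str"
    and \<kappa> :: "'k rel" and lam :: "'c rel" and \<alpha> :: "'o::wellorder"
  assumes aec: "AEC K ls" and CK: "C \<in> mods K" and inf: "Cinfinite \<kappa>" and ls: "ls <o \<kappa>"
    and tame: "fully_tame K C \<kappa>" and short: "fully_type_short K C \<kappa>"
    and nop: "\<not> weak_order_property K C \<kappa>"
    and ex: "nonforking_existence K C \<kappa>" and ext: "nonforking_extension K C \<kappa>"
    and lam: "Card_order lam" "\<kappa> \<le>o lam"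
    and M: "M \<in> models K C" "|univ M| =o lam" and R: "R_ge K C lam M p \<alpha>"
  shows "U_ge K C \<kappa> M p \<alpha>"
  using M R
proof (induction \<alpha> arbitrary: M p rule: less_induct)
  case (less \<alpha>)
  have inflam: "Cinfinite lam" using inf lam cinfinite_mono by blast
  from less.prems(3) show ?case
  proof cases
    case zero
    then show ?thesis by (metis U_ge.zero)
  next
    case limit
    show ?thesis
      by (rule U_ge.limit[OF limit(2)]) (use less.IH less.prems(1,2) limit(3) in blast)
  next
    case large
    then show ?thesis using less.prems(2) not_ordLess_ordIso ordIso_symmetric by blast
  next
    case (succ \<beta> M' P)
    have \<beta>: "\<beta> < \<alpha>" using succ(2) by (simp add: is_succ_def)
    have M'C: "univ M' \<subseteq> univ C" using aec succ(3) by (rule models_univ)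
    have MM': "univ M \<subseteq> univ M'" using aec succ(4) by (rule AEC_prec_univ)
    have rep: "\<exists>A. P i = gtp K C A M' \<and> A \<in> seqs C (dom A) \<and> gtp K C A M = p"
      if i: "i \<in> Field (cardSuc lam)" for i
    proof -
      obtain I A where A: "P i = gtp K C A M'" "A \<in> seqs C I"
        using succ(6)[OF i] by (auto simp: gtypes_def gtypes_len_def)
      moreover have "gtp K C A M = p"
        using succ(6)[OF i] gtp_restrict_gtp[OF aec CK _ MM' M'C, of A] A
        by (simp add: seqs_def)
      ultimately show ?thesis by (auto simp: seqs_def)
    qed
    obtain i A where i: "i \<in> Field (cardSuc lam)" and A: "P i = gtp K C A M'"
      "A \<in> seqs C (dom A)" "gtp K C A M = p" and forks: "\<not> nonforking K C \<kappa> A M M'"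
    proof -
      have "infinite (Field (cardSuc lam))"
        using Cinfinite_cardSuc[OF inflam] by (simp add: cinfinite_def)
      then obtain i j where ij: "i \<in> Field (cardSuc lam)" "j \<in> Field (cardSuc lam)" "i \<noteq> j"
        by (metis finite.emptyI finite_insert finite_subset insertI1 subsetI)
      obtain A where A: "P i = gtp K C A M'" "A \<in> seqs C (dom A)" "gtp K C A M = p"
        using rep[OF ij(1)] by blast
      obtain B where B: "P j = gtp K C B M'" "B \<in> seqs C (dom B)" "gtp K C B M = p"
        using rep[OF ij(2)] by blast
      have "P i \<noteq> P j" using succ(5) ij by (auto dest: inj_onD)
      moreover have AB: "gtp K C A M = gtp K C B M" using A(3) B(3) by simp
      \<comment> \<open>\<open>gtypes\<close> leaves the index set open; it is determined by the
        type over \<open>M\<close>, because automorphisms preserve domains. Uniqueness is stated for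
        a common index set.\<close>
      moreover have "dom B = dom A"
        using gtp_eqD[OF aec CK AB] dom_map_option_comp by metis
      moreover have "\<kappa> \<le>o |univ M|"
        using lam(2) less.prems(2) ordIso_symmetric ordLeq_ordIso_trans by blast
      ultimately have "\<not> nonforking K C \<kappa> A M M' \<or> \<not> nonforking K C \<kappa> B M M'"
        using nonforking_unique[OF aec CK inf ls tame short nop ex ext less.prems(1) _
            succ(3,4), of A "dom A" B] A B by auto
      then show ?thesis using that A B ij by blast
    qed
    obtain J N' where J: "J \<subseteq> dom A" "|J| <o \<kappa>" and N': "prec K N' M'" "|univ N'| <o \<kappa>"
      and nr: "\<not> (\<exists>b. ran b \<subseteq> univ M \<and> b \<in> gtp K C (A |` J) N')"
      using forks unfolding nonforking_def by blast
    \<comment> \<open>The rank U admits only extensions over models of the size of \<open>M\<close>,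
      whereas \<open>M'\<close> may be larger. If it is, a hull of \<open>M\<close> and of the
      witness \<open>N'\<close> inside \<open>M'\<close> replaces it.\<close>
    obtain M'' where M'': "prec K M'' M'" "univ M \<union> univ N' \<subseteq> univ M''" "|univ M''| =o lam"
      and RM'': "R_ge K C lam M'' (gtp K C A M'') \<beta>"
    proof (cases "|univ M'| =o lam")
      case True
      have "prec K M' C" using succ(3) by (simp add: models_def)
      then have "prec K M' M'" using AEC_coherence[OF aec] by blast
      moreover have "univ N' \<subseteq> univ M'" using aec N'(1) by (rule AEC_prec_univ)
      ultimately show ?thesis using that True succ(6)[OF i] A(1) MM' by simp
    next
      case False
      have "|univ M| \<le>o |univ M'|" using MM' by (rule card_of_mono1)
      then have "lam \<le>o |univ M'|"
        using less.prems(2) ordIso_symmetric ordIso_ordLeq_trans by blast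
      then have big: "lam <o |univ M'|"
        using False ordIso_symmetric unfolding ordLeq_iff_ordLess_or_ordIso by blast
      have "|univ M \<union> univ N'| \<le>o lam"
        using less.prems(2) N'(2) lam inflam ordIso_imp_ordLeq ordLess_imp_ordLeq ordLeq_transitive
        by (intro Un_Cinfinite_bound) blast+
      moreover have "univ M \<union> univ N' \<subseteq> univ M'" using MM' AEC_prec_univ[OF aec N'(1)] by blast
      moreover have "ls \<le>o lam"
        using ls lam(2) ordLess_imp_ordLeq ordLeq_transitive by blast
      ultimately obtain M'' where M'': "prec K M'' M'" "univ M \<union> univ N' \<subseteq> univ M''"
        "|univ M''| \<le>o lam"
        using AEC_submodel_ordLeq[OF aec _ _ inflam, of M'] AEC_prec_mods[OF aec succ(4)] by metis
      have "lam \<le>o |univ M''|"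
        using less.prems(2) M''(2) card_of_mono1[of "univ M" "univ M''"]
          ordIso_symmetric ordIso_ordLeq_trans by blast
      then have iso: "|univ M''| =o lam" using M''(3) by (simp add: ordIso_iff_ordLeq)
      \<comment> \<open>Over the larger \<open>M'\<close> the rank is a minimum over submodels of
        size \<open>lam\<close>, so its lower bound passes to the restriction to
        \<open>M''\<close>.\<close>
      have "R_ge K C lam M'' (gtp_restrict K C (P i) M'') \<beta>"
        using succ(6)[OF i] R_ge_large_iff[OF big] M''(1) iso by blast
      moreover have "gtp_restrict K C (P i) M'' = gtp K C A M''"
        using gtp_restrict_gtp[OF aec CK _ AEC_prec_univ[OF aec M''(1)] M'C, of A] A
        by (simp add: seqs_def)
      ultimately show ?thesis using that M'' iso by simp
    qed
    have M''m: "M'' \<in> models K C" using aec succ(3) M''(1) by (rule models_prec)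
    have M''C: "univ M'' \<subseteq> univ C" using aec M''m by (rule models_univ)
    have MM'': "prec K M M''" using AEC_coherence[OF aec succ(4) M''(1)] M''(2) by blast
    \<comment> \<open>By coherence the witness \<open>N'\<close> is a strong submodel of
      \<open>M''\<close>, so \<open>J\<close> and \<open>N'\<close> still show forking
      there.\<close>
    have "prec K N' M''" using AEC_coherence[OF aec N'(1) M''(1)] M''(2) by blast
    then have "\<not> nonforking K C \<kappa> A M M''" using J N'(2) nr unfolding nonforking_def by blast
    moreover have "gtp K C A M'' \<in> gtypes K C M''"
      using A(2) unfolding gtypes_def gtypes_len_def by blast
    moreover have "gtp_restrict K C (gtp K C A M'') M = p"
      using gtp_restrict_gtp[OF aec CK _ _ M''C, of A M] A M''(2) by (simp add: seqs_def)
    ultimately have "forking_extension K C \<kappa> M p M'' (gtp K C A M'')"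
      using MM'' AEC_gtp_refl[OF aec CK] unfolding forking_extension_def by blast
    moreover have "U_ge K C \<kappa> M'' (gtp K C A M'') \<beta>"
      using less.IH[OF \<beta> M''m M''(3) RM''] .
    moreover have "|univ M''| =o |univ M|"
      using M''(3) less.prems(2) ordIso_symmetric ordIso_transitive by blast
    ultimately show ?thesis using U_ge.succ[OF succ(2) M''m] by blast
  qed
qed

theorem theorem7p11:
  fixes K :: "('f, 'r, 'a) aec" and C M :: "('f, 'r, 'a) str"
    and ls :: "'l rel" and \<kappa> :: "'k rel" and lam :: "'c rel"
    and p :: "('a \<rightharpoonup> 'a) set"
  assumes "AEC K ls" and "amalgamation K" and "joint_embedding K" and "no_maximal_models K"
    and "monster K C"
    and "Card_order \<kappa>" and "ls <o \<kappa>"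
    and "fully_tame K C \<kappa>" and "fully_type_short K C \<kappa>" and "\<not> weak_order_property K C \<kappa>"
    and "nonforking_existence K C \<kappa>" and "nonforking_extension K C \<kappa>"
    and "Card_order lam" and "\<kappa> \<le>o lam"
    and "M \<in> models K C" and "|univ M| =o lam" and "p \<in> gtypes K C M"
  shows "(U_rank K C \<kappa> M p :: 'o::wellorder extended) \<ge> R_rank K C lam M p"
proof -
  have CK: "C \<in> mods K" using assms(5) by (simp add: monster_def)
  \<comment> \<open>\<open>\<kappa>\<close> is infinite because it exceeds the Lowenheim-Skolem
    number.\<close>
  have "natLeq \<le>o ls" using AEC_LS_bound[OF assms(1)] by (simp add: LS_bound_def)
  then have "natLeq \<le>o \<kappa>"
    using assms(7) ordLess_imp_ordLeq ordLeq_transitive by blast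
  then have inf: "Cinfinite \<kappa>"
    using assms(6) cinfinite_mono natLeq_cinfinite by blast
  have ge: "U_ge K C \<kappa> M p \<alpha>" if "R_ge K C lam M p \<alpha>" for \<alpha> :: 'o
    using R_ge_imp_U_ge[OF assms(1) CK inf assms(7-16) that] .
  show ?thesis
  proof (cases "R_rank K C lam M p :: 'o extended")
    case (Fin \<alpha>)
    then have "R_ge K C lam M p \<alpha>" using R_rank_ge_iff assms(16) by (metis order_refl)
    then show ?thesis using ge U_rank_ge_iff Fin by metis
  next
    case Pinf
    then have "R_ge K C lam M p \<alpha>" for \<alpha> :: 'o
      using R_rank_ge_iff[of M lam \<alpha> K C p] assms(16) by simp
    then have "(U_rank K C \<kappa> M p :: 'o extended) = Pinf"
      using ge by (simp add: U_rank_def rank_value_def)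
    then show ?thesis by simp
  next
    case Minf
    then show ?thesis by simp
  qed
qed

end
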